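(* Let $n\ge 1$, let $\sigma\in\{(ab),(a-bc),(b-ac),(c-ab),(a-ab),(b-ab)\}$, and let $m=(m_1,\dots,m_n)$ be a vector of positive integers. Put $F_\sigma(m,q)=\sum_{w\in A^*_m}q^{\sigma(w)}$. Then $$F_\sigma(m,q)=\sum_{\emptyset\neq T\subseteq[n]}\ \Bigl(\prod_{j=1}^{|T|-1}\bigl(q^{e_\sigma(m,T,j)}-1\bigr)\Bigr)\,F_\sigma(m-\mathbf 1_T,q),$$ where, writing $T=\{t_1>t_2>\cdots>t_{|T|}\}$, the exponents are \begin{itemize} \item $e_{(ab)}(m,T,j)=1$; \item $e_{(a-bc)}(m,T,j)=m_1+m_2+\cdots+m_{t_{j+1}-1}$; \item $e_{(b-ac)}(m,T,j)=m_{t_{j+1}+1}+m_{t_{j+1}+2}+\cdots+m_{t_j-1}$; \item $e_{(c-ab)}(m,T,j)=m_{t_j+1}+m_{t_j+2}+\cdots+m_n-j+1$; \item $e_{(a-ab)}(m,T,j)=m_{t_{j+1}}-1$; \item $e_{(b-ab)}(m,T,j)=m_{t_j}-1$. \end{itemize} Moreover, if $m\in\mathbb N^n$ has some $m_i=0$, then $F_\sigma(m,q)=F_\sigma(\hat m,q)$ with $\hat m=(m_1,\dots,m_{i-1},m_{i+1},\dots,m_n)$, and $F_\sigma(m,q)=1$ if all $m_i=0$. The same recurrence and initial conditions hold with $\sigma$ replaced by its reversal $\sigma^r$, where $\sigma^r(w)=\sigma(w^r)$ (with the same exponents $e_\sigma$).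
   Context: $[n]=\{1,\dots,n\}$, $\mathbb N=\{0,1,2,\dots\}$. For $m\in\mathbb N^n$, $A^*_m$ is the set of all words in the alphabet $[n]$ containing exactly $m_i$ copies of the letter $i$ for each $i$ (permutations of the multiset). $\mathbf 1_T\in\{0,1\}^n$ is the indicator vector of $T$. Empty products equal $1$ and empty sums equal $0$. $w^r=w_\ell\cdots w_1$ is the reversal of $w=w_1\cdots w_\ell$. Pattern functions count occurrences in a word $w=w_1\cdots w_\ell$: $(ab)(w)=|\{i: w_i<w_{i+1}\}|$. A pattern of the form $(x-yz)$ counts the pairs $(i,j)$ with $1\le i<j<\ell$ such that the letters $w_i,w_j,w_{j+1}$ are order-isomorphic to $x,y,z$ (where $a<b<c$, and equal pattern letters correspond to equal word letters, distinct ones to distinct word letters). So $(a-bc)$ counts pairs with $w_i<w_j<w_{j+1}$; $(b-ac)$: $w_j<w_i<w_{j+1}$; $(c-ab)$: $w_j<w_{j+1}<w_i$; $(a-ab)$: $w_i=w_j<w_{j+1}$; $(b-ab)$: $w_j<w_{j+1}=w_i$. *)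

theory Defs
  imports "HOL-Computational_Algebra.Polynomial"
begin

definition words :: "nat \<Rightarrow> (nat \<Rightarrow> nat) \<Rightarrow> nat list set" where
  "words n m = {w. set w \<subseteq> {1..n} \<and> (\<forall>i\<in>{1..n}. count_list w i = m i)}"

definition order_isomorphic :: "nat list \<Rightarrow> nat list \<Rightarrow> bool" where
  "order_isomorphic u v \<longleftrightarrow> length u = length v \<and>
     (\<forall>a<length u. \<forall>b<length u.
        (u ! a < u ! b \<longleftrightarrow> v ! a < v ! b) \<and> (u ! a = u ! b \<longleftrightarrow> v ! a = v ! b))"

definition ascents :: "nat list \<Rightarrow> nat" where
  "ascents w = card {i. i + 1 < length w \<and> w ! i < w ! (i + 1)}"

(* The pattern x-yz is given as p = [x, y, z]; list positions i, j are 0-based. *)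
definition vincular :: "nat list \<Rightarrow> nat list \<Rightarrow> nat" where
  "vincular p w = card {(i, j). i < j \<and> j + 1 < length w \<and>
     order_isomorphic [w ! i, w ! j, w ! (j + 1)] p}"

datatype pattern = AB | A_BC | B_AC | C_AB | A_AB | B_AB

(* The pattern letters a < b < c are encoded as 1 < 2 < 3. *)
fun occurrences :: "pattern \<Rightarrow> nat list \<Rightarrow> nat" where
  "occurrences AB w = ascents w"
| "occurrences A_BC w = vincular [1, 2, 3] w"
| "occurrences B_AC w = vincular [2, 1, 3] w"
| "occurrences C_AB w = vincular [3, 1, 2] w"
| "occurrences A_AB w = vincular [1, 1, 2] w"
| "occurrences B_AB w = vincular [2, 1, 2] w"

abbreviation q :: "int poly" where
  "q \<equiv> [:0, 1:]"

definition gen_fun :: "(nat list \<Rightarrow> nat) \<Rightarrow> nat \<Rightarrow> (nat \<Rightarrow> nat) \<Rightarrow> int poly" where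
  "gen_fun s n m = (\<Sum>w\<in>words n m. q ^ s w)"

(* The elements of a finite set T, listed as t_1 > t_2 > ... > t_|T|. *)
definition desc_nth :: "nat set \<Rightarrow> nat \<Rightarrow> nat" where
  "desc_nth T j = rev (sorted_list_of_set T) ! (j - 1)"

(* The subtractions do not truncate for positive m, T \<subseteq> {1..n} and 1 \<le> j < |T|;
   in case (c-ab), the elements t_1, ..., t_{j-1} of T all lie in {t_j+1..n},
   so the sum is at least j - 1. *)
fun exponent :: "pattern \<Rightarrow> nat \<Rightarrow> (nat \<Rightarrow> nat) \<Rightarrow> nat set \<Rightarrow> nat \<Rightarrow> nat" where
  "exponent AB n m T j = 1"
| "exponent A_BC n m T j = (\<Sum>k = 1..desc_nth T (j + 1) - 1. m k)"
| "exponent B_AC n m T j = (\<Sum>k = desc_nth T (j + 1) + 1..desc_nth T j - 1. m k)"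
| "exponent C_AB n m T j = (\<Sum>k = desc_nth T j + 1..n. m k) + 1 - j"
| "exponent A_AB n m T j = m (desc_nth T (j + 1)) - 1"
| "exponent B_AB n m T j = m (desc_nth T j) - 1"

definition minus_indicator :: "(nat \<Rightarrow> nat) \<Rightarrow> nat set \<Rightarrow> nat \<Rightarrow> nat" where
  "minus_indicator m T = (\<lambda>i. m i - of_bool (i \<in> T))"

(* The vector (m_1, ..., m_{i-1}, m_{i+1}, ..., m_n). *)
definition delete_entry :: "nat \<Rightarrow> (nat \<Rightarrow> nat) \<Rightarrow> nat \<Rightarrow> nat" where
  "delete_entry i m = (\<lambda>k. if k < i then m k else m (k + 1))"

end

theory Submission imports Defs begin

text \<open>
  Appending a letter \<open>z\<close> to a word \<open>v y\<close> changes \<open>\<sigma>\<close> only if \<open>y < z\<close>, and then by a number \<open>c\<close>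
  that depends on \<open>y\<close>, \<open>z\<close> and the content of \<open>v\<close> alone. Hence \<open>q ^ \<sigma> w\<close> is the product of
  \<open>1 + (q ^ c - 1)\<close> over the ascents of \<open>w\<close>. Expanding only the factors at the end of \<open>w\<close>, up to the
  first ascent from the right where the summand 1 is chosen, writes \<open>q ^ \<sigma> w\<close> as a sum over all
  decompositions \<open>w = u t\<close> with \<open>t\<close> nonempty and strictly increasing. Such a \<open>t\<close> is a nonempty set \<open>T\<close>
  of letters, \<open>u\<close> is an arbitrary word with the remaining content, and since the content of each
  prefix cutting \<open>t\<close> is known, the factors \<open>q ^ c - 1\<close> depend only on \<open>T\<close>.
\<close>

section \<open>Appending one letter to a word\<close>

text \<open>An occurrence that is new in \<open>v @ [y, z]\<close> has the final \<open>y\<close>,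
  \<open>z\<close> as its adjacent pair, so for the vincular patterns only its first letter
  \<open>x\<close>, taken from \<open>v\<close>, is free.\<close>

fun gain :: "pattern \<Rightarrow> nat list \<Rightarrow> nat \<Rightarrow> nat \<Rightarrow> nat" where
  "gain AB v y z = of_bool (y < z)"
| "gain A_BC v y z = length (filter (\<lambda>x. x < y \<and> y < z) v)"
| "gain B_AC v y z = length (filter (\<lambda>x. y < x \<and> x < z) v)"
| "gain C_AB v y z = length (filter (\<lambda>x. y < z \<and> z < x) v)"
| "gain A_AB v y z = length (filter (\<lambda>x. x = y \<and> y < z) v)"
| "gain B_AB v y z = length (filter (\<lambda>x. x = z \<and> y < z) v)"

lemma gain_eq_0: "\<not> y < z \<Longrightarrow> gain \<sigma> v y z = 0"
  by (cases \<sigma>) (auto simp: filter_empty_conv)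

lemma ascents_snoc: "ascents (v @ [y, z]) = ascents (v @ [y]) + of_bool (y < z)"
proof -
  let ?A = "\<lambda>w::nat list. {i. i + 1 < length w \<and> w ! i < w ! (i + 1)}"
  have "?A (v @ [y, z]) = ?A (v @ [y]) \<union> {i. i = length v \<and> y < z}"
    by (auto simp: nth_append less_Suc_eq split: if_splits)
  moreover have "?A (v @ [y]) \<inter> {i. i = length v \<and> y < z} = {}"
    by auto
  moreover have "card {i. i = length v \<and> y < z} = of_bool (y < z)"
    by (cases "y < z") auto
  ultimately show ?thesis
    unfolding ascents_def by (simp add: card_Un_disjoint)
qed

lemma vincular_snoc:
  "vincular p (v @ [y, z]) =
     vincular p (v @ [y]) + length (filter (\<lambda>x. order_isomorphic [x, y, z] p) v)"
proof -
  let ?V = "\<lambda>w. {(i, j). i < j \<and> j + 1 < length w \<and>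
     order_isomorphic [w ! i, w ! j, w ! (j + 1)] p}"
  let ?N = "{i. i < length v \<and> order_isomorphic [v ! i, y, z] p}"
  have eq: "?V (v @ [y, z]) = ?V (v @ [y]) \<union> (\<lambda>i. (i, length v)) ` ?N"
    by (auto simp: nth_append less_Suc_eq image_iff split: if_splits)
  have "?V (v @ [y]) \<subseteq> {..length v} \<times> {..length v}"
    by auto
  then have "finite (?V (v @ [y]))"
    by (rule finite_subset) simp
  moreover have "?V (v @ [y]) \<inter> (\<lambda>i. (i, length v)) ` ?N = {}"
    by auto
  moreover have "card ((\<lambda>i. (i, length v)) ` ?N) =
      length (filter (\<lambda>x. order_isomorphic [x, y, z] p) v)"
    by (subst card_image) (auto simp: inj_on_def length_filter_conv_card)
  ultimately show ?thesis
    unfolding vincular_def eq by (simp add: card_Un_disjoint)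
qed

text \<open>The right-hand sides are literally the filter conditions of \<open>gain\<close>, so the
  snoc lemmas for all patterns combine by rewriting alone.\<close>

lemma order_isomorphic_patterns:
  "order_isomorphic [x, y, z] [1, 2, 3] \<longleftrightarrow> x < y \<and> y < z"
  "order_isomorphic [x, y, z] [2, 1, 3] \<longleftrightarrow> y < x \<and> x < z"
  "order_isomorphic [x, y, z] [3, 1, 2] \<longleftrightarrow> y < z \<and> z < x"
  "order_isomorphic [x, y, z] [1, 1, 2] \<longleftrightarrow> x = y \<and> y < z"
  "order_isomorphic [x, y, z] [2, 1, 2] \<longleftrightarrow> x = z \<and> y < z"
  by (auto simp: order_isomorphic_def All_less_Suc)

lemma occurrences_snoc:
  "occurrences \<sigma> (v @ [y, z]) = occurrences \<sigma> (v @ [y]) + gain \<sigma> v y z"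
  by (cases \<sigma>) (simp_all only: occurrences.simps gain.simps ascents_snoc vincular_snoc
      order_isomorphic_patterns)

lemma occurrences_short: "length w \<le> 1 \<Longrightarrow> occurrences \<sigma> w = 0"
  by (cases \<sigma>) (auto simp: ascents_def vincular_def)

section \<open>Expansion over splits with an increasing second part\<close>

text \<open>Only adjacent pairs inside \<open>t\<close> contribute. The junction of a nonempty
  \<open>u\<close> with \<open>t\<close> has no factor: there the summand 1 was chosen, or there is
  no ascent.\<close>

definition suffix_factor :: "pattern \<Rightarrow> nat list \<Rightarrow> nat list \<Rightarrow> int poly" where
  "suffix_factor \<sigma> u t =
     (\<Prod>i<length t - 1. q ^ gain \<sigma> (u @ take i t) (t ! i) (t ! Suc i) - 1)"

lemma suffix_factor_singleton [simp]: "suffix_factor \<sigma> u [z] = 1"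
  by (simp add: suffix_factor_def)

lemma suffix_factor_snoc:
  "suffix_factor \<sigma> u (t @ [y, z]) =
     suffix_factor \<sigma> u (t @ [y]) * (q ^ gain \<sigma> (u @ t) y z - 1)"
proof -
  have "(\<Prod>i<length t. q ^ gain \<sigma> (u @ take i (t @ [y, z])) ((t @ [y, z]) ! i)
            ((t @ [y, z]) ! Suc i) - 1) =
        (\<Prod>i<length t. q ^ gain \<sigma> (u @ take i (t @ [y])) ((t @ [y]) ! i)
            ((t @ [y]) ! Suc i) - 1)"
    by (intro prod.cong refl) (auto simp: nth_append less_Suc_eq)
  then show ?thesis
    by (simp add: suffix_factor_def nth_append)
qed

definition increasing_splits :: "nat list \<Rightarrow> (nat list \<times> nat list) set" where
  "increasing_splits w = {(u, t). u @ t = w \<and> t \<noteq> [] \<and> sorted_wrt (<) t}"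

lemma finite_increasing_splits: "finite (increasing_splits w)"
proof -
  have "increasing_splits w \<subseteq> (\<lambda>k. (take k w, drop k w)) ` {..length w}"
  proof
    fix x assume "x \<in> increasing_splits w"
    then obtain u t where "x = (u, t)" "u @ t = w"
      by (auto simp: increasing_splits_def)
    then show "x \<in> (\<lambda>k. (take k w, drop k w)) ` {..length w}"
      by (intro image_eqI[of _ _ "length u"]) auto
  qed
  then show ?thesis
    by (rule finite_subset) simp
qed

lemma increasing_splits_singleton: "increasing_splits [z] = {([], [z])}"
  by (auto simp: increasing_splits_def append_eq_Cons_conv)

text \<open>Removing the final \<open>z\<close> from the second part leaves either nothing or the
  second part of a split of \<open>v @ [y]\<close>. The latter ends in its maximum \<open>y\<close>,
  so \<open>y < z\<close> is the only extra condition.\<close>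

lemma increasing_splits_snoc:
  "increasing_splits (v @ [y, z]) = insert (v @ [y], [z])
     (if y < z then (\<lambda>(u, t). (u, t @ [z])) ` increasing_splits (v @ [y]) else {})"
proof (rule set_eqI, clarify)
  fix u t
  show "(u, t) \<in> increasing_splits (v @ [y, z]) \<longleftrightarrow> (u, t) \<in> insert (v @ [y], [z])
     (if y < z then (\<lambda>(u, t). (u, t @ [z])) ` increasing_splits (v @ [y]) else {})"
  proof (cases t rule: rev_cases)
    case Nil
    then show ?thesis by (auto simp: increasing_splits_def)
  next
    case (snoc t' z')
    have split: "u @ t' = v @ [y] \<and> t' \<noteq> [] \<longleftrightarrow> (\<exists>t''. t' = t'' @ [y] \<and> v = u @ t'')"
      by (cases t' rule: rev_cases) auto
    have "u @ t = v @ [y, z] \<longleftrightarrow> u @ t' = v @ [y] \<and> z' = z"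
      using append1_eq_conv[of "u @ t'" z' "v @ [y]" z] by (simp add: snoc)
    then have lhs: "(u, t) \<in> increasing_splits (v @ [y, z]) \<longleftrightarrow>
        u @ t' = v @ [y] \<and> z' = z \<and> sorted_wrt (<) (t' @ [z])"
      by (auto simp: increasing_splits_def snoc)
    have image: "(u, t) \<in> (\<lambda>(u, t). (u, t @ [z])) ` increasing_splits (v @ [y]) \<longleftrightarrow>
        z' = z \<and> (u, t') \<in> increasing_splits (v @ [y])"
      by (auto simp: snoc)
    show ?thesis
    proof (cases "t' = []")
      case True
      then show ?thesis
        unfolding lhs by (simp add: image) (auto simp: snoc increasing_splits_def)
    next
      case False
      have "sorted_wrt (<) (t' @ [z]) \<longleftrightarrow> y < z \<and> sorted_wrt (<) t'" if eq: "u @ t' = v @ [y]"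
      proof -
        obtain t'' where "t' = t'' @ [y]"
          using split False eq by blast
        moreover have "\<forall>x\<in>set t''. x < z" if "\<forall>x\<in>set t''. x < y" "y < z"
          using that less_trans by blast
        ultimately show ?thesis
          by (auto simp: sorted_wrt_append)
      qed
      then have "(u, t) \<in> increasing_splits (v @ [y, z]) \<longleftrightarrow>
          y < z \<and> z' = z \<and> (u, t') \<in> increasing_splits (v @ [y])"
        using False unfolding lhs by (auto simp: increasing_splits_def)
      then show ?thesis
        using False by (simp add: image) (simp add: snoc)
    qed
  qed
qed

text \<open>Induction on the last letter, writing \<open>q ^ gain\<close> as 1 +
  (\<open>q ^ gain\<close> - 1): the summand 1 yields the split with second part \<open>[z]\<close>,
  the other one extends every split of the shorter word by \<open>z\<close>.\<close>

lemma power_occurrences_expand: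
  assumes "w \<noteq> []"
  shows "q ^ occurrences \<sigma> w =
     (\<Sum>(u, t)\<in>increasing_splits w. suffix_factor \<sigma> u t * q ^ occurrences \<sigma> u)"
  using assms
proof (induction w rule: rev_induct)
  case Nil
  then show ?case by simp
next
  case (snoc z w)
  show ?case
  proof (cases w rule: rev_cases)
    case Nil
    then show ?thesis
      by (simp add: increasing_splits_singleton occurrences_short)
  next
    case w: (snoc v y)
    let ?f = "\<lambda>(u, t). suffix_factor \<sigma> u t * q ^ occurrences \<sigma> u"
    let ?S = "increasing_splits (v @ [y])"
    let ?g = "gain \<sigma> v y z"
    have IH: "q ^ occurrences \<sigma> (v @ [y]) = sum ?f ?S"
      using snoc.IH w by simp
    show ?thesis
    proof (cases "y < z")
      case False
      \<comment> \<open>The gain is 0 and \<open>[z]\<close> is the only increasing second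
        part.\<close>
      then show ?thesis
        using occurrences_snoc[of \<sigma> v y z]
        by (simp add: w increasing_splits_snoc gain_eq_0)
    next
      case True
      have nin: "(v @ [y], [z]) \<notin> (\<lambda>(u, t). (u, t @ [z])) ` ?S"
        by (auto simp: increasing_splits_def)
      have "sum ?f (increasing_splits (v @ [y, z])) =
          ?f (v @ [y], [z]) + sum ?f ((\<lambda>(u, t). (u, t @ [z])) ` ?S)"
        using True nin by (simp add: increasing_splits_snoc finite_increasing_splits)
      also have "sum ?f ((\<lambda>(u, t). (u, t @ [z])) ` ?S) = (\<Sum>(u, t)\<in>?S. ?f (u, t @ [z]))"
        by (subst sum.reindex) (auto simp: inj_on_def case_prod_unfold)
      also have "\<dots> = (\<Sum>x\<in>?S. ?f x * (q ^ ?g - 1))"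
      proof (intro sum.cong refl, clarify)
        \<comment> \<open>The second part of any split of \<open>v @ [y]\<close> ends in
          \<open>y\<close>, so the prefix before the new pair is \<open>v\<close> whatever the
          split; the new factor therefore leaves the sum.\<close>
        fix u t assume "(u, t) \<in> ?S"
        then obtain t' where "t = t' @ [y]" "v = u @ t'"
          by (cases t rule: rev_cases) (auto simp: increasing_splits_def)
        then show "suffix_factor \<sigma> u (t @ [z]) * q ^ occurrences \<sigma> u =
            suffix_factor \<sigma> u t * q ^ occurrences \<sigma> u * (q ^ ?g - 1)"
          using suffix_factor_snoc[of \<sigma> u t' y z] by (simp add: mult_ac)
      qed
      also have "\<dots> = q ^ occurrences \<sigma> (v @ [y]) * (q ^ ?g - 1)"
        unfolding IH sum_distrib_right ..
      finally show ?thesis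
        using occurrences_snoc[of \<sigma> v y z] by (simp add: w power_add algebra_simps)
    qed
  qed
qed

section \<open>Words of given content\<close>

lemma length_filter_mem_eq_sum_count:
  assumes "finite X"
  shows "length (filter (\<lambda>x. x \<in> X) v) = (\<Sum>x\<in>X. count_list v x)"
proof (induction v)
  case (Cons a v)
  have "(\<Sum>x\<in>X. count_list (a # v) x) =
      (\<Sum>x\<in>X. (if x = a then 1 else 0) + count_list v x)"
    by (intro sum.cong) auto
  also have "\<dots> = (if a \<in> X then 1 else 0) + (\<Sum>x\<in>X. count_list v x)"
    by (simp only: sum.distrib sum.delta[OF assms])
  finally show ?case
    using Cons by simp
qed simp

lemma words_count: "w \<in> words n m \<Longrightarrow> x \<in> {1..n} \<Longrightarrow> count_list w x = m x"
  by (simp add: words_def)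

lemma finite_words: "finite (words n m)"
proof (rule finite_subset)
  show "words n m \<subseteq> {w. set w \<subseteq> {1..n} \<and> length w = (\<Sum>i=1..n. m i)}"
  proof
    fix w assume w: "w \<in> words n m"
    then have "filter (\<lambda>x. x \<in> {1..n}) w = w"
      by (intro filter_True) (auto simp: words_def)
    then have "length w = (\<Sum>i=1..n. m i)"
      using length_filter_mem_eq_sum_count[of "{1..n}" w] w by (simp add: words_def)
    then show "w \<in> {w. set w \<subseteq> {1..n} \<and> length w = (\<Sum>i=1..n. m i)}"
      using w by (simp add: words_def)
  qed
qed (simp add: finite_lists_length_eq)

lemma count_list_distinct: "distinct xs \<Longrightarrow> count_list xs x = of_bool (x \<in> set xs)"
  by (induction xs) auto

text \<open>Positivity of \<open>m\<close> makes the truncated subtraction in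
  \<open>minus_indicator\<close> exact; if some \<open>i\<close> in \<open>T\<close> had
  \<open>m i = 0\<close>, the direction from right to left would fail.\<close>

lemma words_append_increasing_iff:
  assumes "\<forall>i\<in>{1..n}. m i > 0" "T \<subseteq> {1..n}"
  shows "u @ sorted_list_of_set T \<in> words n m \<longleftrightarrow> u \<in> words n (minus_indicator m T)"
proof -
  have "finite T"
    using assms(2) finite_subset by blast
  moreover from this have "count_list (u @ sorted_list_of_set T) i = m i \<longleftrightarrow>
      count_list u i = minus_indicator m T i" if "i \<in> {1..n}" for i
    using assms(1) that
    by (auto simp: minus_indicator_def count_list_distinct)
  ultimately show ?thesis
    using assms(2) by (auto simp: words_def)
qed

section \<open>From gains to exponents\<close>

text \<open>The prefix \<open>u @ take i t\<close> has content \<open>m\<close> minus the letters of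
  \<open>drop i t\<close>, which are \<open>t ! i\<close>, \<open>t ! Suc i\<close> and then larger
  ones. So each vincular gain is a sum of entries of \<open>m\<close>, corrected by the remaining
  letters in the range counted.\<close>

lemma gain_eq_exponent:
  fixes n m T
  defines "t \<equiv> sorted_list_of_set T"
  assumes T: "T \<subseteq> {1..n}" and w: "u @ t \<in> words n m" and i: "Suc i < card T"
  shows "gain \<sigma> (u @ take i t) (t ! i) (t ! Suc i) = exponent \<sigma> n m T (card T - 1 - i)"
proof -
  have fin: "finite T"
    using T finite_subset by blast
  have len: "length t = card T" and set_t: "set t = T" and sorted: "sorted_wrt (<) t"
    using fin by (simp_all add: t_def)
  let ?v = "u @ take i t" and ?y = "t ! i" and ?z = "t ! Suc i"
  \<comment> \<open>\<open>t\<close> increases while t_1 > t_2 > ... decreases: for j =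
    \<open>card T - 1 - i\<close>, the 0-based entries \<open>i\<close> and \<open>Suc i\<close> of
    \<open>t\<close> are t_(j+1) and t_j.\<close>
  have desc: "desc_nth T (card T - 1 - i + 1) = ?y" "desc_nth T (card T - 1 - i) = ?z"
    using i len by (simp_all add: desc_nth_def rev_nth Suc_diff_Suc flip: t_def)
  have yz: "?y < ?z"
    using sorted i len by (simp add: sorted_wrt_nth_less)
  have mem: "?y \<in> {1..n}" "?z \<in> {1..n}"
    using i len T set_t nth_mem[of i t] nth_mem[of "Suc i" t] by auto
  have drop: "drop i t = ?y # ?z # drop (i + 2) t"
    using i len by (simp add: Cons_nth_drop_Suc)
  have sd: "sorted_wrt (<) (drop i t)"
    using sorted by (rule sorted_wrt_drop)
  have large: "x > ?z" if "x \<in> set (drop (i + 2) t)" for x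
    using sd that unfolding drop by simp
  have dist: "distinct (drop i t)"
    by (simp add: t_def)
  have count: "count_list ?v x + of_bool (x \<in> set (drop i t)) = m x" if "x \<in> {1..n}" for x
  proof -
    have "count_list ?v x + count_list (drop i t) x = m x"
      using words_count[OF w that] count_list_append[of "take i t" "drop i t" x] by simp
    moreover have "count_list (drop i t) x = of_bool (x \<in> set (drop i t))"
      using dist by (rule count_list_distinct)
    ultimately show ?thesis by simp
  qed
  \<comment> \<open>\<open>X\<close> is the range of letters selected by \<open>P\<close>; the
    cardinality accounts for the letters of \<open>X\<close> still missing from the prefix.\<close>
  have filter_eq: "length (filter P ?v) + card (X \<inter> set (drop i t)) = (\<Sum>x\<in>X. m x)"
    if "X \<subseteq> {1..n}" "\<And>x. x \<in> {1..n} \<Longrightarrow> P x \<longleftrightarrow> x \<in> X" for P X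
  proof -
    have finX: "finite X"
      using that(1) finite_subset by blast
    have "set ?v \<subseteq> {1..n}"
      using w set_take_subset[of i t] by (auto simp: words_def)
    then have "filter P ?v = filter (\<lambda>x. x \<in> X) ?v"
      using that(2) by (intro filter_cong) auto
    then have "length (filter P ?v) = (\<Sum>x\<in>X. count_list ?v x)"
      by (simp only: length_filter_mem_eq_sum_count[OF finX])
    moreover have "card (X \<inter> set (drop i t)) = (\<Sum>x\<in>X. of_bool (x \<in> set (drop i t)))"
      using finX by simp
    ultimately have "length (filter P ?v) + card (X \<inter> set (drop i t)) =
        (\<Sum>x\<in>X. count_list ?v x + of_bool (x \<in> set (drop i t)))"
      by (simp only: sum.distrib)
    also have "\<dots> = (\<Sum>x\<in>X. m x)"
      using that(1) by (intro sum.cong refl count) blast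
    finally show ?thesis .
  qed
  show ?thesis
  proof (cases \<sigma>)
    case AB
    then show ?thesis using yz by simp
  next
    case A_BC
    \<comment> \<open>No remaining letter is below \<open>?y\<close>, and in the next case none lies
      strictly between the consecutive \<open>?y\<close> and \<open>?z\<close>: no correction
      arises.\<close>
    have "{1..?y - 1} \<inter> set (drop i t) = {}"
      using large yz by (fastforce simp: drop)
    moreover have "{1..?y - 1} \<subseteq> {1..n}"
      using mem by auto
    moreover have "x < ?y \<and> ?y < ?z \<longleftrightarrow> x \<in> {1..?y - 1}" if "x \<in> {1..n}" for x
      using that yz by auto
    ultimately show ?thesis
      using A_BC filter_eq[of "{1..?y - 1}" "\<lambda>x. x < ?y \<and> ?y < ?z"] desc by simp
  next
    case B_AC
    have "{?y + 1..?z - 1} \<inter> set (drop i t) = {}"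
      using large yz by (fastforce simp: drop)
    moreover have "{?y + 1..?z - 1} \<subseteq> {1..n}"
      using mem by auto
    moreover have "?y < x \<and> x < ?z \<longleftrightarrow> x \<in> {?y + 1..?z - 1}" for x
      by auto
    ultimately show ?thesis
      using B_AC filter_eq[of "{?y + 1..?z - 1}" "\<lambda>x. ?y < x \<and> x < ?z"] desc by simp
  next
    case C_AB
    \<comment> \<open>The remaining letters above \<open>?z\<close> number
      \<open>card T - (i + 2)\<close>, that is j - 1 for j = \<open>card T - 1 - i\<close>; this is
      the origin of \<open>+ 1 - j\<close>.\<close>
    have "{?z + 1..n} \<inter> set (drop i t) = set (drop (i + 2) t)"
      using large yz T set_t set_drop_subset[of "i + 2" t] by (fastforce simp: drop)
    moreover have "card (set (drop (i + 2) t)) = card T - (i + 2)"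
      using len by (subst distinct_card) (auto simp: t_def)
    moreover have "?y < ?z \<and> ?z < x \<longleftrightarrow> x \<in> {?z + 1..n}" if "x \<in> {1..n}" for x
      using that yz by auto
    moreover have "{?z + 1..n} \<subseteq> {1..n}"
      by auto
    ultimately have
      "length (filter (\<lambda>x. ?y < ?z \<and> ?z < x) ?v) + (card T - (i + 2)) = (\<Sum>x = ?z + 1..n. m x)"
      using filter_eq[of "{?z + 1..n}" "\<lambda>x. ?y < ?z \<and> ?z < x"] by presburger
    then show ?thesis
      unfolding C_AB gain.simps exponent.simps desc using i by linarith
  next
    case A_AB
    \<comment> \<open>Exactly one copy of \<open>?y\<close> is missing from the prefix, whence
      \<open>m ?y - 1\<close>; the last case is the same with \<open>?z\<close>.\<close>
    have "{?y} \<inter> set (drop i t) = {?y}"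
      by (simp add: drop)
    then show ?thesis
      using A_AB filter_eq[of "{?y}" "\<lambda>x. x = ?y \<and> ?y < ?z"] yz mem desc by auto
  next
    case B_AB
    have "{?z} \<inter> set (drop i t) = {?z}"
      by (simp add: drop)
    then show ?thesis
      using B_AB filter_eq[of "{?z}" "\<lambda>x. x = ?z \<and> ?y < ?z"] yz mem desc by auto
  qed
qed

text \<open>The right-hand side is free of \<open>u\<close>, so the factor can be taken out of the
  sum over all \<open>u\<close> that go with \<open>T\<close>.\<close>

lemma suffix_factor_eq_prod_exponent:
  assumes "T \<subseteq> {1..n}" "u @ sorted_list_of_set T \<in> words n m"
  shows "suffix_factor \<sigma> u (sorted_list_of_set T) =
    (\<Prod>j = 1..card T - 1. q ^ exponent \<sigma> n m T j - 1)"
proof -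
  have "finite T"
    using assms(1) finite_subset by blast
  then have "suffix_factor \<sigma> u (sorted_list_of_set T) =
      (\<Prod>i<card T - 1. q ^ exponent \<sigma> n m T (card T - 1 - i) - 1)"
    unfolding suffix_factor_def using gain_eq_exponent[OF assms]
    by (intro prod.cong) auto
  also have "\<dots> = (\<Prod>j = 1..card T - 1. q ^ exponent \<sigma> n m T j - 1)"
    by (intro prod.reindex_bij_witness[of _ "\<lambda>j. card T - 1 - j" "\<lambda>i. card T - 1 - i"]) auto
  finally show ?thesis .
qed

section \<open>The recurrence\<close>

lemma gen_fun_recurrence:
  assumes n: "n \<ge> 1" and m: "\<forall>i\<in>{1..n}. m i > 0"
  shows "gen_fun (occurrences \<sigma>) n m =
    (\<Sum>T | T \<noteq> {} \<and> T \<subseteq> {1..n}. (\<Prod>j = 1..card T - 1. q ^ exponent \<sigma> n m T j - 1) *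
       gen_fun (occurrences \<sigma>) n (minus_indicator m T))"
proof -
  let ?f = "\<lambda>u t. suffix_factor \<sigma> u t * q ^ occurrences \<sigma> u"
  let ?\<T> = "{T. T \<noteq> {} \<and> T \<subseteq> {1..n}}"
  have fin: "finite T" if "T \<in> ?\<T>" for T
    using that finite_subset by blast
  \<comment> \<open>The empty word has no split, so the expansion must not meet it; here the letter
    1 occurs in every word.\<close>
  have ne: "w \<noteq> []" if "w \<in> words n m" for w
    using that n m by (force simp: words_def)
  have "gen_fun (occurrences \<sigma>) n m =
      (\<Sum>w\<in>words n m. \<Sum>(u, t)\<in>increasing_splits w. ?f u t)"
    unfolding gen_fun_def by (intro sum.cong refl power_occurrences_expand ne)
  also have "\<dots> = (\<Sum>(w, u, t)\<in>(SIGMA w:words n m. increasing_splits w). ?f u t)"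
    by (subst sum.Sigma) (auto simp: finite_words finite_increasing_splits case_prod_unfold)
  \<comment> \<open>Nonempty strictly increasing lists are the sorted lists of nonempty finite sets,
    and \<open>w\<close> is recovered as \<open>u @ t\<close>; so the triples
    \<open>(w, u, t)\<close> correspond to the pairs \<open>(T, u)\<close>.\<close>
  also have "\<dots> = (\<Sum>(T, u)\<in>(SIGMA T:?\<T>. words n (minus_indicator m T)).
      ?f u (sorted_list_of_set T))"
  proof (rule sum.reindex_bij_witness[of _
        "\<lambda>(T, u). (u @ sorted_list_of_set T, u, sorted_list_of_set T)" "\<lambda>(w, u, t). (set t, u)"],
      goal_cases)
    case (1 x)
    then show ?case
      by (auto simp: increasing_splits_def strict_sorted_equal sorted_list_of_set.idem_if_sorted_distinct
          strict_sorted_iff)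
  next
    case (2 x)
    then obtain w u t where x: "x = (w, u, t)" "w \<in> words n m" "u @ t = w" "t \<noteq> []"
        "sorted_wrt (<) t"
      by (auto simp: increasing_splits_def)
    then have t: "sorted_list_of_set (set t) = t"
      by (simp add: sorted_list_of_set.idem_if_sorted_distinct strict_sorted_iff)
    have "set t \<subseteq> {1..n}"
      using x by (auto simp: words_def)
    then show ?case
      using words_append_increasing_iff[OF m, of "set t" u] x t by auto
  next
    case (3 x)
    then show ?case using fin by (cases x) auto
  next
    case (4 x)
    then show ?case
      using words_append_increasing_iff[OF m] fin
      by (cases x) (auto simp: increasing_splits_def)
  next
    case (5 x)
    then show ?case
      by (auto simp: increasing_splits_def sorted_list_of_set.idem_if_sorted_distinct
          strict_sorted_iff)
  qed
  also have "\<dots> = (\<Sum>T\<in>?\<T>. \<Sum>u\<in>words n (minus_indicator m T). ?f u (sorted_list_of_set T))"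
    by (subst sum.Sigma) (auto simp: finite_words)
  also have "\<dots> = (\<Sum>T\<in>?\<T>. (\<Prod>j = 1..card T - 1. q ^ exponent \<sigma> n m T j - 1) *
       gen_fun (occurrences \<sigma>) n (minus_indicator m T))"
    unfolding gen_fun_def sum_distrib_left
    using words_append_increasing_iff[OF m] suffix_factor_eq_prod_exponent
    by (intro sum.cong refl) auto
  finally show ?thesis .
qed

section \<open>Reversal and initial conditions\<close>

text \<open>Reversal is an involution on \<open>words n m\<close>, so the reversed patterns need no
  recurrence of their own.\<close>

lemma gen_fun_rev: "gen_fun (\<lambda>w. s (rev w)) n m = gen_fun s n m"
  unfolding gen_fun_def
  by (intro sum.reindex_bij_witness[of _ rev rev]) (auto simp: words_def)

text \<open>All six patterns depend only on comparisons between letters.\<close>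

lemma occurrences_map_strict_mono:
  assumes f: "strict_mono f"
  shows "occurrences \<sigma> (map f w) = occurrences \<sigma> w"
proof -
  have "order_isomorphic (map f v) p \<longleftrightarrow> order_isomorphic v p" for v p
    by (simp add: order_isomorphic_def strict_mono_less[OF f] strict_mono_eq[OF f] cong: conj_cong)
  from this[of "[x, y, z]" for x y z]
  have "order_isomorphic [f x, f y, f z] p \<longleftrightarrow> order_isomorphic [x, y, z] p" for x y z p
    by simp
  then have "vincular p (map f w) = vincular p w" for p
    unfolding vincular_def
    by (intro arg_cong[where f = card]) auto
  moreover have "ascents (map f w) = ascents w"
    unfolding ascents_def
    by (intro arg_cong[where f = card]) (auto simp: strict_mono_less[OF f])
  ultimately show ?thesis
    by (cases \<sigma>) auto
qed

lemma gen_fun_delete_entry: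
  assumes i: "i \<in> {1..n}" and mi: "m i = 0"
  shows "gen_fun (occurrences \<sigma>) n m = gen_fun (occurrences \<sigma>) (n - 1) (delete_entry i m)"
proof -
  \<comment> \<open>\<open>?up\<close> enumerates the naturals other than \<open>i\<close>
    increasingly, and \<open>?down\<close> inverts it. The value of \<open>?down\<close> at
    \<open>i\<close> is harmless, as \<open>i\<close> occurs in no word of content
    \<open>m\<close>.\<close>
  let ?up = "\<lambda>k::nat. if k < i then k else k + 1"
  let ?down = "\<lambda>k::nat. if k < i then k else k - 1"
  have up: "strict_mono ?up"
    by (auto simp: strict_mono_def)
  have inj: "inj ?up"
    using up by (rule strict_mono_imp_inj_on)
  have up_down: "?up (?down k) = k" if "k \<noteq> i" for k
    using that by auto
  have i_notin: "i \<notin> set w" if "w \<in> words n m" for w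
    using that i mi by (simp add: words_def flip: count_list_0_iff)
  have ud: "map ?up (map ?down w) = w" if "w \<in> words n m" for w
  proof -
    have "map (\<lambda>k. ?up (?down k)) w = w"
      using i_notin[OF that] by (intro map_idI up_down) auto
    then show ?thesis by (simp add: comp_def)
  qed
  have count_up: "count_list (map ?up w) (?up x) = count_list w x" for w x
    using inj by (rule count_list_map_conv)
  have down_mem: "map ?down w \<in> words (n - 1) (delete_entry i m)" if w: "w \<in> words n m" for w
  proof -
    have "count_list (map ?down w) x = delete_entry i m x" if "x \<in> {1..n - 1}" for x
    proof -
      have "count_list (map ?down w) x = count_list w (?up x)"
        using count_up[of "map ?down w" x] ud[OF w] by simp
      then show ?thesis
        using w that i by (auto simp: words_def delete_entry_def)
    qed
    moreover have "?down x \<in> {1..n - 1}" if "x \<in> set w" for x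
    proof -
      have "x \<in> {1..n}" "x \<noteq> i"
        using that w i_notin[OF w] by (auto simp: words_def)
      then show ?thesis
        using i by auto
    qed
    then have "set (map ?down w) \<subseteq> {1..n - 1}"
      unfolding set_map by (rule image_subsetI)
    ultimately show ?thesis
      by (simp add: words_def)
  qed
  have up_mem: "map ?up w \<in> words n m" if w: "w \<in> words (n - 1) (delete_entry i m)" for w
  proof -
    have "count_list (map ?up w) x = m x" if x: "x \<in> {1..n}" for x
    proof (cases "x = i")
      case True
      then show ?thesis
        using mi by (auto simp: count_list_0_iff)
    next
      case False
      then have "count_list (map ?up w) x = count_list w (?down x)"
        using count_up[of w "?down x"] up_down[of x] by simp
      moreover have "?down x \<in> {1..n - 1}"
        using False x i by auto
      ultimately have "count_list (map ?up w) x = delete_entry i m (?down x)"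
        using words_count[OF w] by simp
      then show ?thesis
        using False by (auto simp: delete_entry_def)
    qed
    moreover have "\<forall>x\<in>set w. x \<in> {1..n - 1}"
      using w by (auto simp: words_def)
    then have "set (map ?up w) \<subseteq> {1..n}"
      by auto
    ultimately show ?thesis
      by (simp add: words_def)
  qed
  have du: "map ?down (map ?up w) = w" for w
    by (simp add: map_idI)
  show ?thesis
    unfolding gen_fun_def
  proof (intro sum.reindex_bij_witness[of _ "map ?up" "map ?down"] ud du up_mem down_mem)
    \<comment> \<open>\<open>?down\<close> identifies \<open>i - 1\<close> and \<open>i\<close>,
      hence is not strictly monotone; invariance is applied to \<open>?up\<close> on
      \<open>map ?down w\<close> instead.\<close>
    fix w assume "w \<in> words n m"
    then show "q ^ occurrences \<sigma> (map ?down w) = q ^ occurrences \<sigma> w"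
      using occurrences_map_strict_mono[OF up, of \<sigma> "map ?down w"] by (simp only: ud)
  qed
qed

lemma gen_fun_zero:
  assumes "\<forall>i\<in>{1..n}. m i = 0"
  shows "gen_fun (occurrences \<sigma>) n m = 1"
proof -
  have "words n m = {[]}"
  proof (intro equalityI subsetI)
    fix w assume "w \<in> words n m"
    then have "x \<notin> set w" for x
      using assms by (fastforce simp: words_def count_list_0_iff)
    then show "w \<in> {[]}" by (cases w) auto
  qed (use assms in \<open>auto simp: words_def\<close>)
  then show ?thesis
    by (simp add: gen_fun_def occurrences_short)
qed

theorem mainTheorem2:
  fixes n :: nat and \<sigma> :: pattern and s :: "nat list \<Rightarrow> nat"
  assumes "n \<ge> 1"
    and "s = occurrences \<sigma> \<or> s = (\<lambda>w. occurrences \<sigma> (rev w))"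
  shows "(\<forall>m. (\<forall>i\<in>{1..n}. m i > 0) \<longrightarrow>
           gen_fun s n m =
             (\<Sum>T | T \<noteq> {} \<and> T \<subseteq> {1..n}.
                (\<Prod>j = 1..card T - 1. q ^ exponent \<sigma> n m T j - 1) *
                gen_fun s n (minus_indicator m T))) \<and>
         (\<forall>m. \<forall>i\<in>{1..n}. m i = 0 \<longrightarrow>
           gen_fun s n m = gen_fun s (n - 1) (delete_entry i m)) \<and>
         (\<forall>m. (\<forall>i\<in>{1..n}. m i = 0) \<longrightarrow> gen_fun s n m = 1)"
proof -
  \<comment> \<open>This is stated for every \<open>k\<close>, since deleting an entry passes from
    \<open>n\<close> to \<open>n - 1\<close>.\<close>
  have "gen_fun s k m = gen_fun (occurrences \<sigma>) k m" for k m
    using assms(2) gen_fun_rev[of "occurrences \<sigma>"] by auto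
  then show ?thesis
    using gen_fun_recurrence[OF assms(1)] gen_fun_delete_entry gen_fun_zero by auto
qed

end
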